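(* Let $\mathbb{F}$ be a field of characteristic zero, let $X=\{x_1,\ldots,x_n\}$, and let $f\in\mathbb{F}\langle X,X^{-1}\rangle$ be a nonzero expression of degree $d$. Then $f$ is not an identity for the matrix algebra $\mathbb{M}_{2d}(\mathbb{F})$. That is, there exist invertible matrices $a_1,\ldots,a_n\in\mathbb{M}_{2d}(\mathbb{F})$ such that $f(a_1,\ldots,a_n)\neq 0$.
   Context: $\mathbb{F}\langle X,X^{-1}\rangle$ denotes the free group algebra over $\mathbb{F}$ on the free group generated by $x_1,\ldots,x_n$. Its elements are finite $\mathbb{F}$-linear combinations $f=\sum_w \alpha_w w$ of reduced words $w$, i.e. words over $\{x_1,\ldots,x_n,x_1^{-1},\ldots,x_n^{-1}\}$ containing no adjacent pair $x_ix_i^{-1}$ or $x_i^{-1}x_i$. The only relations are $x_ix_i^{-1}=x_i^{-1}x_i=1$. The degree of $f$ is the maximum length of a reduced word $w$ with $\alpha_w\neq0$. For an associative $\mathbb{F}$-algebra $A$ with identity, $f$ is an identity for $A$ if $f(a_1,\ldots,a_n)=0$ for all $a_1,\ldots,a_n\in A$ such that each $a_i^{-1}$ exists. Here $f(a_1,\ldots,a_n)$ is obtained by substituting $a_i$ for $x_i$ and $a_i^{-1}$ for $x_i^{-1}$. *)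

theory Defs
  imports "Jordan_Normal_Form.Matrix" "HOL-Library.Poly_Mapping"
begin

datatype letter = Gen nat | GenInv nat

primrec letter_index :: "letter \<Rightarrow> nat" where
  "letter_index (Gen i) = i"
| "letter_index (GenInv i) = i"

primrec letter_inverse :: "letter \<Rightarrow> letter" where
  "letter_inverse (Gen i) = GenInv i"
| "letter_inverse (GenInv i) = Gen i"

definition reduced_words :: "nat \<Rightarrow> letter list set" where
  "reduced_words n =
     {w. letter_index ` set w \<subseteq> {1..n} \<and> successively (\<lambda>x y. y \<noteq> letter_inverse x) w}"

text \<open>
  An element of the free group algebra on the generators \<open>Gen 1, \<dots>, Gen n\<close> is a finitely
  supported family of coefficients indexed by reduced words, the normal forms of the elements
  of the free group.
\<close>

definition free_group_algebra :: "nat \<Rightarrow> (letter list \<Rightarrow>\<^sub>0 'f::zero) set" where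
  "free_group_algebra n = {f. Poly_Mapping.keys f \<subseteq> reduced_words n}"

text \<open>Only meaningful for nonzero \<open>f\<close>.\<close>

definition fga_degree :: "(letter list \<Rightarrow>\<^sub>0 'f::zero) \<Rightarrow> nat" where
  "fga_degree f = Max (length ` Poly_Mapping.keys f)"

text \<open>
  An associative unital algebra over \<open>'f\<close> is given by a record of type \<open>module\<close>, which carries
  the ring operations together with the scalar multiplication.
\<close>

primrec letter_eval :: "('f, 'a, 'm) module_scheme \<Rightarrow> (nat \<Rightarrow> 'a) \<Rightarrow> letter \<Rightarrow> 'a" where
  "letter_eval A a (Gen i) = a i"
| "letter_eval A a (GenInv i) = inv\<^bsub>A\<^esub> (a i)"

primrec word_eval :: "('f, 'a, 'm) module_scheme \<Rightarrow> (nat \<Rightarrow> 'a) \<Rightarrow> letter list \<Rightarrow> 'a" where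
  "word_eval A a [] = \<one>\<^bsub>A\<^esub>"
| "word_eval A a (l # w) = letter_eval A a l \<otimes>\<^bsub>A\<^esub> word_eval A a w"

definition fga_eval ::
    "('f::zero, 'a, 'm) module_scheme \<Rightarrow> (nat \<Rightarrow> 'a) \<Rightarrow> (letter list \<Rightarrow>\<^sub>0 'f) \<Rightarrow> 'a" where
  "fga_eval A a f = (\<Oplus>\<^bsub>A\<^esub>w \<in> Poly_Mapping.keys f. Poly_Mapping.lookup f w \<odot>\<^bsub>A\<^esub> word_eval A a w)"

definition is_identity_for ::
    "nat \<Rightarrow> (letter list \<Rightarrow>\<^sub>0 'f::zero) \<Rightarrow> ('f, 'a, 'm) module_scheme \<Rightarrow> bool" where
  "is_identity_for n f A \<longleftrightarrow>
     (\<forall>a. (\<forall>i\<in>{1..n}. a i \<in> Units A) \<longrightarrow> fga_eval A a f = \<zero>\<^bsub>A\<^esub>)"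

text \<open>
  The record \<^const>\<open>module_mat\<close> has matrix multiplication as its product, so for a square
  size it is the full matrix algebra.
\<close>

abbreviation matrix_algebra :: "'f::semiring_1 itself \<Rightarrow> nat \<Rightarrow> ('f, 'f mat) module" where
  "matrix_algebra ty m \<equiv> module_mat ty m m"

end

theory Submission
  imports Defs "HOL-Computational_Algebra.Polynomial"
begin

text \<open>
  Let \<open>w\<close> be a word of maximal length \<open>d\<close> in \<open>f\<close>, read as the labels of a path on the vertices
  \<open>0, \<dots>, d\<close>.  The path splits into maximal runs of a single letter.  Since \<open>w\<close> is reduced, the
  runs of \<open>l\<close> and of its inverse are pairwise vertex-disjoint, so one may let \<open>l\<close> act as \<open>t (1 + N)\<close>
  on the runs of \<open>l\<close>, as \<open>t\<inverse> (1 + N)\<inverse>\<close> on the runs of its inverse, and trivially elsewhere, where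
  \<open>N\<close> is the shift along the run; the matrices of \<open>l\<close> and its inverse are then mutually inverse.
  The part of a letter linear in \<open>t\<close> is upper bidiagonal, with a superdiagonal \<open>1\<close> exactly at the
  edges with that label.  Hence in the entry \<open>(0, d)\<close> of \<open>f\<close> the coefficient of \<open>t ^ d\<close> is the
  coefficient of \<open>w\<close>, and some nonzero value of \<open>t\<close> makes this entry nonzero.
\<close>

section \<open>Letter matrices along a reduced word\<close>

definition edge :: "letter list \<Rightarrow> letter \<Rightarrow> nat \<Rightarrow> bool" where
  "edge w l p \<longleftrightarrow> p < length w \<and> w ! p = l"

text \<open>Runs are sets of vertices, so the final vertex of a run belongs to it although no edge
  with that label leaves it.\<close>

definition in_run :: "letter list \<Rightarrow> letter \<Rightarrow> nat \<Rightarrow> bool" where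
  "in_run w l p \<longleftrightarrow> edge w l p \<or> (\<exists>q. p = Suc q \<and> edge w l q)"

definition step :: "letter list \<Rightarrow> letter \<Rightarrow> nat \<Rightarrow> nat \<Rightarrow> 'f::field" where
  "step w l p q = (if q = p \<or> q = Suc p \<and> edge w l p then 1 else 0)"

text \<open>Entries of the Neumann series 1 - N + N^2 - ... for (1 + N)^-1, where N is the nilpotent
  shift along the edges labelled \<open>l\<close>.\<close>

definition alt_path :: "letter list \<Rightarrow> letter \<Rightarrow> nat \<Rightarrow> nat \<Rightarrow> 'f::field" where
  "alt_path w l p q = (if p \<le> q \<and> (\<forall>j\<in>{p..<q}. edge w l j) then (-1) ^ (q - p) else 0)"

text \<open>The rule is symmetric in \<open>l\<close> and its inverse, so \<open>Gen i\<close> and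
  \<open>GenInv i\<close> need no separate treatment.\<close>

definition letter_entry :: "letter list \<Rightarrow> letter \<Rightarrow> 'f::field \<Rightarrow> nat \<Rightarrow> nat \<Rightarrow> 'f" where
  "letter_entry w l t p q =
     (if in_run w l p then t * step w l p q
      else if in_run w (letter_inverse l) p then inverse t * alt_path w (letter_inverse l) p q
      else if p = q then 1 else 0)"

definition letter_mat :: "letter list \<Rightarrow> nat \<Rightarrow> 'f::field \<Rightarrow> letter \<Rightarrow> 'f mat" where
  "letter_mat w m t l = mat m m (\<lambda>(p, q). letter_entry w l t p q)"

lemma letter_mat_carrier [simp]: "letter_mat w m t l \<in> carrier_mat m m"
  by (simp add: letter_mat_def)

lemma letter_inverse_inverse [simp]: "letter_inverse (letter_inverse l) = l"
  by (cases l) auto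

lemma letter_inverse_neq: "letter_inverse l \<noteq> l"
  by (cases l) auto

text \<open>At a common vertex, either one edge would carry both labels, or two consecutive edges
  would carry mutually inverse letters.\<close>

lemma in_run_disjoint:
  assumes "successively (\<lambda>x y. y \<noteq> letter_inverse x) w" "in_run w l p"
  shows "\<not> in_run w (letter_inverse l) p"
proof -
  have "w ! Suc q \<noteq> letter_inverse (w ! q)" if "Suc q < length w" for q
    using assms(1) that by (auto simp: successively_conv_nth)
  then show ?thesis
    using assms(2) letter_inverse_neq[of l] unfolding in_run_def edge_def
    by (metis letter_inverse_inverse nat.inject)
qed

text \<open>This is (1 + N) (1 + N)^-1 = 1 entrywise: a path of positive length is split at its
  first edge, and the two signs cancel.\<close>

lemma alt_path_out: "alt_path w l p q + (if edge w l p then alt_path w l (Suc p) q else 0)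
   = (if p = q then 1 else 0)"
proof (cases "p < q")
  case True
  then have "{p..<q} = insert p {Suc p..<q}" and "q - p = Suc (q - Suc p)" by auto
  with True show ?thesis by (auto simp: alt_path_def)
qed (auto simp: alt_path_def)

text \<open>The product in the other order, with the path split at its last edge.\<close>

lemma alt_path_in:
  "alt_path w l p q + (if 0 < q \<and> edge w l (q - 1) then alt_path w l p (q - 1) else 0)
   = (if p = q then 1 else 0)"
proof (cases "p < q")
  case True
  then obtain r where q: "q = Suc r" and "p \<le> r" by (cases q) auto
  then have "{p..<q} = insert r {p..<r}" by auto
  with q \<open>p \<le> r\<close> show ?thesis by (auto simp: alt_path_def Suc_diff_le)
qed (auto simp: alt_path_def)

lemma in_run_end:
  assumes "in_run w l p" "p \<le> q" "\<forall>j\<in>{p..<q}. edge w l j"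
  shows "in_run w l q"
proof (cases "p = q")
  case False
  with assms(2) obtain r where "q = Suc r" "p \<le> r" by (cases q) auto
  with assms(3) show ?thesis by (auto simp: in_run_def)
qed (use assms(1) in simp)

text \<open>The factors t and t^-1 cancel, and the position of row \<open>p\<close> decides which of
  the identities \<open>alt_path_out\<close> and \<open>alt_path_in\<close> remains, or that the row
  is trivial.\<close>

lemma letter_entry_mult_inverse:
  fixes t :: "'f::field"
  assumes red: "successively (\<lambda>x y. y \<noteq> letter_inverse x) w" and t: "t \<noteq> 0"
    and m: "length w < m" "p < m" "q < m"
  shows "(\<Sum>k<m. letter_entry w l t p k * letter_entry w (letter_inverse l) t k q)
    = (if p = q then 1 else 0)"
proof -
  define l' where "l' = letter_inverse l"
  have l: "letter_inverse l' = l" by (simp add: l'_def)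
  have disj: "\<not> in_run w l' k" if "in_run w l k" for k
    using in_run_disjoint[OF red that] by (simp add: l'_def)
  have Suc_m: "Suc k < m" if "edge w x k" for x k
    using that m(1) by (auto simp: edge_def)
  consider "in_run w l p" | "\<not> in_run w l p" "in_run w l' p"
    | "\<not> in_run w l p" "\<not> in_run w l' p" by blast
  then have "(\<Sum>k<m. letter_entry w l t p k * letter_entry w l' t k q) = (if p = q then 1 else 0)"
  proof cases
    case 1
    have "letter_entry w l t p k * letter_entry w l' t k q =
        (if k = p then alt_path w l p q else 0)
        + (if k = Suc p then if edge w l p then alt_path w l (Suc p) q else 0 else 0)" for k
    proof -
      have "in_run w l (Suc p)" if "edge w l p" using that by (auto simp: in_run_def)
      with 1 disj t show ?thesis by (auto simp: letter_entry_def step_def l l'_def[symmetric])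
    qed
    then show ?thesis
      using m Suc_m[of l p] alt_path_out[of w l p q, where 'a = 'f]
      by (cases "edge w l p") (simp_all add: sum.distrib)
  next
    case 2
    \<comment> \<open>Truncated subtraction makes \<open>q - 1\<close> equal to \<open>q\<close> at
      \<open>q = 0\<close>; the guard \<open>0 < q\<close> prevents counting that column
      twice.\<close>
    have "letter_entry w l t p k * letter_entry w l' t k q =
        (if k = q then alt_path w l' p q else 0)
        + (if k = q - 1 then if 0 < q \<and> edge w l' (q - 1) then alt_path w l' p (q - 1) else 0 else 0)" for k
    proof (cases "in_run w l' k")
      case True
      with 2 t show ?thesis by (auto simp: letter_entry_def step_def l l'_def[symmetric])
    next
      case False
      then have *: "alt_path w l' p k = (0::'f)"
        using in_run_end[OF 2(2), of k] by (auto simp: alt_path_def)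
      moreover have "\<not> (k = q - 1 \<and> 0 < q \<and> edge w l' (q - 1))"
        using False by (auto simp: in_run_def)
      ultimately show ?thesis
        using 2 by (auto simp: letter_entry_def l'_def[symmetric])
    qed
    then show ?thesis
      using m alt_path_in[of w l' p q, where 'a = 'f]
      by (auto simp: sum.distrib)
  next
    case 3
    then have "letter_entry w l t p k * letter_entry w l' t k q =
        (if k = p then if p = q then 1 else 0 else 0)" for k
      by (auto simp: letter_entry_def l l'_def[symmetric])
    then show ?thesis using m by simp
  qed
  then show ?thesis by (simp add: l'_def)
qed

lemma letter_mat_mult_inverse:
  fixes t :: "'f::field"
  assumes "successively (\<lambda>x y. y \<noteq> letter_inverse x) w" "t \<noteq> 0" "length w < m"
  shows "letter_mat w m t l * letter_mat w m t (letter_inverse l) = 1\<^sub>m m"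
proof (rule eq_matI)
  fix p q assume "p < dim_row (1\<^sub>m m :: 'f mat)" "q < dim_col (1\<^sub>m m :: 'f mat)"
  then have pq: "p < m" "q < m" by auto
  then have "(letter_mat w m t l * letter_mat w m t (letter_inverse l)) $$ (p, q) =
      (\<Sum>k<m. letter_entry w l t p k * letter_entry w (letter_inverse l) t k q)"
    by (simp add: letter_mat_def scalar_prod_def atLeast0LessThan)
  with letter_entry_mult_inverse[OF assms pq, of l] pq
  show "(letter_mat w m t l * letter_mat w m t (letter_inverse l)) $$ (p, q) = 1\<^sub>m m $$ (p, q)"
    by simp
qed (auto simp: letter_mat_def)

section \<open>Leading coefficients of Laurent polynomial functions\<close>

text \<open>
  \<open>g\<close> is a Laurent polynomial with exponents between \<open>- k\<close> and \<open>k\<close> away from \<open>0\<close>, and \<open>c\<close>, possibly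
  zero, is its coefficient at \<open>t ^ k\<close>.
\<close>

definition has_lead :: "nat \<Rightarrow> 'f \<Rightarrow> ('f::field \<Rightarrow> 'f) \<Rightarrow> bool" where
  "has_lead k c g \<longleftrightarrow> (\<exists>p. degree p \<le> 2 * k \<and> coeff p (2 * k) = c \<and> (\<forall>t. t \<noteq> 0 \<longrightarrow> t ^ k * g t = poly p t))"

text \<open>Every other term of the convolution exceeds one of the two bounds. Bounds replace
  degrees because the tracked coefficients may vanish.\<close>

lemma coeff_mult_degree_bounds:
  fixes p q :: "'a::comm_semiring_0 poly"
  assumes "degree p \<le> m" "degree q \<le> n"
  shows "coeff (p * q) (m + n) = coeff p m * coeff q n"
proof -
  have "coeff p i * coeff q (m + n - i) = (if i = m then coeff p m * coeff q n else 0)"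
    if "i \<le> m + n" for i
  proof (cases i m rule: linorder_cases)
    case less
    then have "coeff q (m + n - i) = 0" using assms by (intro coeff_eq_0) auto
    with less show ?thesis by simp
  next
    case greater
    then have "coeff p i = 0" using assms by (intro coeff_eq_0) auto
    with greater show ?thesis by simp
  qed simp
  then have "coeff (p * q) (m + n) = (\<Sum>i\<le>m + n. if i = m then coeff p m * coeff q n else 0)"
    unfolding coeff_mult by (intro sum.cong) auto
  then show ?thesis by simp
qed

lemma has_lead_const: "has_lead 0 c (\<lambda>_. c)"
  unfolding has_lead_def by (intro exI[of _ "[:c:]"]) auto

lemma has_lead_add:
  assumes "has_lead k c g" "has_lead k d h"
  shows "has_lead k (c + d) (\<lambda>t. g t + h t)"
proof -
  from assms obtain p q where "degree p \<le> 2 * k" "coeff p (2 * k) = c"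
      "\<forall>t. t \<noteq> 0 \<longrightarrow> t ^ k * g t = poly p t"
      "degree q \<le> 2 * k" "coeff q (2 * k) = d" "\<forall>t. t \<noteq> 0 \<longrightarrow> t ^ k * h t = poly q t"
    unfolding has_lead_def by blast
  then show ?thesis
    unfolding has_lead_def by (intro exI[of _ "p + q"]) (auto simp: degree_add_le algebra_simps)
qed

lemma has_lead_mult:
  assumes "has_lead k c g" "has_lead j d h"
  shows "has_lead (k + j) (c * d) (\<lambda>t. g t * h t)"
proof -
  from assms obtain p q where *: "degree p \<le> 2 * k" "coeff p (2 * k) = c"
      "\<And>t. t \<noteq> 0 \<Longrightarrow> t ^ k * g t = poly p t"
      "degree q \<le> 2 * j" "coeff q (2 * j) = d" "\<And>t. t \<noteq> 0 \<Longrightarrow> t ^ j * h t = poly q t"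
    unfolding has_lead_def by metis
  have "degree (p * q) \<le> 2 * (k + j)"
    unfolding distrib_left using degree_mult_le add_mono[OF *(1,4)] by (rule order_trans)
  moreover have "coeff (p * q) (2 * (k + j)) = c * d"
    using coeff_mult_degree_bounds[OF *(1,4)] *(2,5) by (simp add: distrib_left)
  moreover have "t ^ (k + j) * (g t * h t) = poly (p * q) t" if "t \<noteq> 0" for t
    by (simp add: *(3,6)[OF that, symmetric] power_add algebra_simps)
  ultimately show ?thesis unfolding has_lead_def by blast
qed

lemma has_lead_one:
  assumes "\<And>t. t \<noteq> 0 \<Longrightarrow> g t = c * t + b + a * inverse t"
  shows "has_lead 1 c g"
proof -
  have "t ^ 1 * g t = poly [:a, b, c:] t" if "t \<noteq> 0" for t
    using assms[OF that] that by (simp add: algebra_simps)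
  moreover have "degree [:a, b, c:] \<le> 2 * 1" "coeff [:a, b, c:] (2 * 1) = c"
    by (simp_all add: coeff_pCons numeral_2_eq_2)
  ultimately show ?thesis unfolding has_lead_def by blast
qed

text \<open>The constant 1, viewed with exponent bound 1, has leading coefficient 0; multiplying by
  it raises the bound by one. This disposes of words shorter than the degree.\<close>

lemma has_lead_weaken:
  assumes "has_lead j c g" "j < k"
  shows "has_lead k 0 g"
proof -
  have *: "has_lead (Suc i) 0 g" if "has_lead i b g" for i b
  proof -
    have "has_lead 1 0 (\<lambda>_. 1)" by (rule has_lead_one[of _ _ 1 0]) simp
    from has_lead_mult[OF this that] show ?thesis by simp
  qed
  from \<open>j < k\<close> show ?thesis
  proof (induction k)
    case (Suc k)
    then have "j = k \<or> j < k" by auto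
    with Suc.IH * assms(1) show ?case by blast
  qed simp
qed

lemma has_lead_sum:
  assumes "\<And>x. x \<in> S \<Longrightarrow> has_lead k (c x) (g x)"
  shows "has_lead k (\<Sum>x\<in>S. c x) (\<lambda>t. \<Sum>x\<in>S. g x t)"
proof -
  have "has_lead k 0 (\<lambda>_. 0)" unfolding has_lead_def by (intro exI[of _ 0]) auto
  with assms show ?thesis
    by (induction S rule: infinite_finite_induct) (auto intro: has_lead_add)
qed

text \<open>In characteristic zero the field is infinite, so some point avoids both 0 and the
  finitely many roots of the polynomial representing \<open>g\<close>.\<close>

lemma has_lead_nonzero:
  fixes g :: "'f::field_char_0 \<Rightarrow> 'f"
  assumes "has_lead k c g" "c \<noteq> 0"
  obtains t where "t \<noteq> 0" "g t \<noteq> 0"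
proof -
  from assms obtain p where p: "coeff p (2 * k) \<noteq> 0" "\<And>t. t \<noteq> 0 \<Longrightarrow> t ^ k * g t = poly p t"
    unfolding has_lead_def by blast
  from p(1) have "p \<noteq> 0" by auto
  have "finite (insert 0 {t. poly p t = 0})" using poly_roots_finite[OF \<open>p \<noteq> 0\<close>] by simp
  then obtain t where "t \<notin> insert 0 {t. poly p t = 0}"
    using ex_new_if_finite infinite_UNIV_char_0 by blast
  then have t: "t \<noteq> 0" "poly p t \<noteq> 0" by auto
  with p(2)[of t] have "g t \<noteq> 0" by auto
  with t(1) show thesis by (rule that)
qed

section \<open>The leading coefficient of a word\<close>

text \<open>The coefficient of t in \<open>letter_entry\<close>; rows outside the runs of
  \<open>l\<close> involve only t^0 or t^-1.\<close>

definition letter_lead :: "letter list \<Rightarrow> letter \<Rightarrow> nat \<Rightarrow> nat \<Rightarrow> 'f::field" where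
  "letter_lead w l p q = (if in_run w l p then step w l p q else 0)"

lemma has_lead_letter: "has_lead 1 (letter_lead w l p q) (\<lambda>t. letter_entry w l t p q)"
proof -
  consider "in_run w l p" | "\<not> in_run w l p" "in_run w (letter_inverse l) p"
    | "\<not> in_run w l p" "\<not> in_run w (letter_inverse l) p" by blast
  then show ?thesis
  proof cases
    case 1
    then show ?thesis by (intro has_lead_one[of _ _ 0 0]) (simp add: letter_entry_def letter_lead_def)
  next
    case 2
    then show ?thesis
      by (intro has_lead_one[of _ _ 0 "alt_path w (letter_inverse l) p q"])
        (simp add: letter_entry_def letter_lead_def)
  next
    case 3
    then show ?thesis
      by (intro has_lead_one[of _ _ "if p = q then 1 else 0" 0])
        (simp add: letter_entry_def letter_lead_def)
  qed
qed

primrec word_mat :: "letter list \<Rightarrow> nat \<Rightarrow> 'f::field \<Rightarrow> letter list \<Rightarrow> 'f mat" where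
  "word_mat w m t [] = 1\<^sub>m m"
| "word_mat w m t (l # v) = letter_mat w m t l * word_mat w m t v"

primrec word_lead :: "letter list \<Rightarrow> nat \<Rightarrow> letter list \<Rightarrow> nat \<Rightarrow> nat \<Rightarrow> 'f::field" where
  "word_lead w m [] p q = (if p = q then 1 else 0)"
| "word_lead w m (l # v) p q = (\<Sum>k<m. letter_lead w l p k * word_lead w m v k q)"

lemma word_mat_carrier [simp]: "word_mat w m t v \<in> carrier_mat m m"
  by (induction v) (auto intro: mult_carrier_mat[of _ m m])

lemma has_lead_word:
  assumes "p < m" "q < m"
  shows "has_lead (length v) (word_lead w m v p q) (\<lambda>t :: 'f::field. word_mat w m t v $$ (p, q))"
  using assms(1)
proof (induction v arbitrary: p)
  case Nil
  with assms(2) show ?case using has_lead_const[of "if p = q then 1 else 0"] by simp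
next
  case (Cons l v)
  have "has_lead (1 + length v) (\<Sum>k<m. letter_lead w l p k * word_lead w m v k q)
      (\<lambda>t :: 'f. \<Sum>k<m. letter_entry w l t p k * word_mat w m t v $$ (k, q))"
    by (intro has_lead_sum has_lead_mult has_lead_letter Cons.IH) auto
  moreover have "word_mat w m t (l # v) $$ (p, q) =
      (\<Sum>k<m. letter_entry w l t p k * word_mat w m t v $$ (k, q))" for t :: 'f
    using Cons.prems assms(2) carrier_matD[OF word_mat_carrier[of w m t v]]
    by (auto simp: letter_mat_def scalar_prod_def atLeast0LessThan intro!: sum.cong)
  ultimately show ?case by simp
qed

text \<open>Each leading letter matrix advances the index by at most one.\<close>

lemma word_lead_beyond:
  assumes "p + length v < q"
  shows "word_lead w m v p q = (0 :: 'f::field)"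
  using assms
proof (induction v arbitrary: p)
  case (Cons l v)
  have "letter_lead w l p k * word_lead w m v k q = (0 :: 'f)" for k
    using Cons.IH[of k] Cons.prems by (auto simp: letter_lead_def step_def)
  then show ?case unfolding word_lead.simps by (intro sum.neutral ballI)
qed simp

text \<open>A path from \<open>p\<close> to \<open>p + length v\<close> uses up one edge per letter, so it has no loops and spells \<open>v\<close>.\<close>

lemma word_lead_path:
  assumes "length w < m" "p + length v \<le> length w"
  shows "word_lead w m v p (p + length v) =
    (if take (length v) (drop p w) = v then 1 else 0 :: 'f::field)"
  using assms(2)
proof (induction v arbitrary: p)
  case (Cons l v)
  let ?q = "Suc p + length v"
  from Cons.prems have p: "p < length w" by simp
  have "letter_lead w l p k * word_lead w m v k ?q =
      (if k = Suc p then if w ! p = l then word_lead w m v (Suc p) ?q else 0 else (0::'f))" for k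
    using p word_lead_beyond[of p v ?q w m, where 'f = 'f]
    by (auto simp: letter_lead_def step_def in_run_def edge_def)
  then have "word_lead w m (l # v) p ?q =
      (if w ! p = l then word_lead w m v (Suc p) ?q else (0::'f))"
    using p assms(1) by simp
  also have "\<dots> = (if take (length (l # v)) (drop p w) = l # v then 1 else 0)"
    using Cons.IH[of "Suc p"] Cons.prems p by (simp add: Cons_nth_drop_Suc[symmetric])
  finally show ?case by simp
qed simp

section \<open>Evaluation in the matrix algebra\<close>

text \<open>The algebra inverse is a definite description, so uniqueness of two-sided inverses has
  to be supplied.\<close>

lemma inv_module_mat:
  fixes A B :: "'f::comm_ring_1 mat"
  assumes "A \<in> carrier_mat m m" "B \<in> carrier_mat m m" "A * B = 1\<^sub>m m" "B * A = 1\<^sub>m m"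
  shows "inv\<^bsub>module_mat TYPE('f) m m\<^esub> A = B"
  unfolding m_inv_def module_mat_simps
proof (rule the_equality)
  fix C assume C: "C \<in> carrier_mat m m \<and> A * C = 1\<^sub>m m \<and> C * A = 1\<^sub>m m"
  then have "C = C * (A * B)" using assms(3) right_mult_one_mat[of C m m] by simp
  also have "\<dots> = (C * A) * B" using assms(1,2) C by (intro assoc_mult_mat[symmetric]) auto
  also have "\<dots> = B" using C left_mult_one_mat[OF assms(2)] by simp
  finally show "C = B" .
qed (use assms in auto)

lemma index_finsum_module_mat:
  fixes g :: "'b \<Rightarrow> 'f::comm_ring_1 mat"
  assumes "finite S" "g \<in> S \<rightarrow> carrier_mat m n" "p < m" "q < n"
  shows "finsum (module_mat TYPE('f) m n) g S $$ (p, q) = (\<Sum>x\<in>S. g x $$ (p, q))"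
proof -
  interpret abelian_group "module_mat TYPE('f) m n" by (rule abelian_group_mat)
  show ?thesis using assms(1,2)
  proof (induction S)
    case empty
    with assms show ?case by (simp add: module_mat_simps)
  next
    case (insert x S)
    then have g: "g \<in> S \<rightarrow> carrier (module_mat TYPE('f) m n)"
      "g x \<in> carrier (module_mat TYPE('f) m n)"
      by (auto simp: module_mat_simps)
    have "finsum (module_mat TYPE('f) m n) g S \<in> carrier_mat m n"
      using finsum_closed[OF g(1)] by (simp add: module_mat_simps)
    with insert finsum_insert[OF insert(1,2) g] assms(3,4) show ?case
      by (simp add: module_mat_simps)
  qed
qed

theorem theorem1:
  fixes f :: "letter list \<Rightarrow>\<^sub>0 'f::field_char_0" and n d :: nat
  assumes "f \<in> free_group_algebra n"
    and "f \<noteq> 0"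
    and "fga_degree f = d"
    and "d \<ge> 1"
  shows "\<not> is_identity_for n f (matrix_algebra TYPE('f) (2 * d)) \<and>
    (\<exists>a :: nat \<Rightarrow> 'f mat.
       (\<forall>i\<in>{1..n}. a i \<in> carrier_mat (2 * d) (2 * d) \<and> invertible_mat (a i)) \<and>
       fga_eval (matrix_algebra TYPE('f) (2 * d)) a f \<noteq> 0\<^sub>m (2 * d) (2 * d))"
proof -
  define m where "m = 2 * d"
  let ?A = "matrix_algebra TYPE('f) m"
  let ?K = "Poly_Mapping.keys f" and ?c = "Poly_Mapping.lookup f"
  have fin: "finite (length ` ?K)" by simp
  moreover have "length ` ?K \<noteq> {}" using assms(2) by simp
  ultimately have "d \<in> length ` ?K"
    using Max_in assms(3) unfolding fga_degree_def by blast
  then obtain w where w: "w \<in> ?K" "length w = d" by auto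
  have len: "length v \<le> d" if "v \<in> ?K" for v
    using Max_ge[OF fin] that assms(3) by (auto simp: fga_degree_def)
  have red: "successively (\<lambda>x y. y \<noteq> letter_inverse x) w"
    using assms(1) w(1) by (auto simp: free_group_algebra_def reduced_words_def)
  \<comment> \<open>From d >= 1 follows d < 2d, so all vertices 0, ..., d of the path are valid
    indices.\<close>
  have dm: "length w < m" "0 < m" "d < m" using w(2) assms(4) by (auto simp: m_def)
  have "has_lead d (?c v * (if v = w then 1 else 0)) (\<lambda>t. ?c v * word_mat w m t v $$ (0, d))"
    if v: "v \<in> ?K" for v
  proof -
    \<comment> \<open>A word of length d contributes at t^d exactly when it spells the whole path,
      that is, equals \<open>w\<close>; a shorter word has too small an exponent.\<close>
    have "has_lead d (if v = w then 1 else 0) (\<lambda>t :: 'f. word_mat w m t v $$ (0, d))"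
    proof (cases "length v = d")
      case True
      then have "word_lead w m v 0 d = (if v = w then 1 else 0 :: 'f)"
        using word_lead_path[OF dm(1), of 0 v, where 'f = 'f] w(2) by auto
      then show ?thesis using has_lead_word[OF dm(2,3), of v w, where 'f = 'f] True by simp
    next
      case False
      with len[OF v] w(2) have "length v < d" "v \<noteq> w" by auto
      with has_lead_weaken[OF has_lead_word[OF dm(2,3)], of v d w] show ?thesis by simp
    qed
    from has_lead_mult[OF has_lead_const[of "?c v"] this] show ?thesis by simp
  qed
  then have "has_lead d (\<Sum>v\<in>?K. ?c v * (if v = w then 1 else 0))
      (\<lambda>t. \<Sum>v\<in>?K. ?c v * word_mat w m t v $$ (0, d))"
    by (rule has_lead_sum)
  also have "(\<Sum>v\<in>?K. ?c v * (if v = w then 1 else 0)) = ?c w"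
    using w(1) by (simp add: if_distrib cong: if_cong)
  finally have lead: "has_lead d (?c w) (\<lambda>t. \<Sum>v\<in>?K. ?c v * word_mat w m t v $$ (0, d))" .
  have "?c w \<noteq> 0" using w(1) by (simp add: in_keys_iff)
  with lead obtain t :: 'f where t: "t \<noteq> 0" "(\<Sum>v\<in>?K. ?c v * word_mat w m t v $$ (0, d)) \<noteq> 0"
    by (rule has_lead_nonzero)
  define a where "a i = letter_mat w m t (Gen i)" for i
  define b where "b i = letter_mat w m t (GenInv i)" for i
  \<comment> \<open>The instances for \<open>Gen i\<close> and \<open>GenInv i\<close> give the two
    one-sided inverse identities.\<close>
  have ab: "a i \<in> carrier_mat m m" "b i \<in> carrier_mat m m" "a i * b i = 1\<^sub>m m" "b i * a i = 1\<^sub>m m" for i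
    using letter_mat_mult_inverse[OF red t(1) dm(1), of "Gen i"]
      letter_mat_mult_inverse[OF red t(1) dm(1), of "GenInv i"]
    by (auto simp: a_def b_def)
  have "letter_eval ?A a l = letter_mat w m t l" for l
    by (cases l) (use inv_module_mat[OF ab] in \<open>auto simp: a_def b_def\<close>)
  then have "word_eval ?A a v = word_mat w m t v" for v
    by (induction v) (auto simp: module_mat_simps)
  then have "fga_eval ?A a f $$ (0, d) = (\<Sum>v\<in>?K. ?c v * word_mat w m t v $$ (0, d))"
    unfolding fga_eval_def using dm carrier_matD[OF word_mat_carrier[of w m t]]
    by (subst index_finsum_module_mat) (auto simp: module_mat_simps intro!: sum.cong)
  with t(2) dm have ne: "fga_eval ?A a f \<noteq> 0\<^sub>m m m" by auto
  have "a i \<in> Units ?A" for i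
    using ab[of i] by (auto simp: Units_def module_mat_simps)
  with ne have "\<not> is_identity_for n f ?A"
    unfolding is_identity_for_def by (auto simp: module_mat_simps)
  moreover have "invertible_mat (a i)" for i
    using ab[of i] unfolding invertible_mat_def inverts_mat_def by fastforce
  ultimately show ?thesis using ne ab(1) unfolding m_def by blast
qed

end
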